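(* Let $K_1$ be a Cantor set in $\mathbb{R}^d$ and let $T_0\in\mathsf{GL}_d(\mathbb{R})$. Then there exist a Cantor set $K_2\subset\mathbb{R}^d$ and $\epsilon>0$ such that $$\left(\bigcap_{\{T\in\mathsf{GL}_d(\mathbb{R}):\ \|T-T_0\|_F<\epsilon\}}(TK_1+K_2)\right)^{\circ}\neq\varnothing .$$
   Context: A Cantor set in $\mathbb{R}^d$ is a (non-empty) compact, totally disconnected, perfect subset of $\mathbb{R}^d$. $\mathsf{GL}_d(\mathbb{R})$ is the set of invertible real $d\times d$ matrices, and $\|T\|_F=\big(\sum_{i,j=1}^d|T_{ij}|^2\big)^{1/2}$ is the Frobenius norm. $E^\circ$ denotes the interior of $E$, and $A+B=\{a+b:a\in A,b\in B\}$. *)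

theory Defs
  imports "HOL-Analysis.Analysis"
begin

definition totally_disconnected_set :: "'a::topological_space set \<Rightarrow> bool" where
  "totally_disconnected_set S \<longleftrightarrow> (\<forall>x\<in>S. connected_component_set S x = {x})"

definition perfect_subset :: "'a::topological_space set \<Rightarrow> bool" where
  "perfect_subset S \<longleftrightarrow> closed S \<and> (\<forall>x\<in>S. x islimpt S)"

definition cantor_set :: "'a::topological_space set \<Rightarrow> bool" where
  "cantor_set K \<longleftrightarrow>
     K \<noteq> {} \<and> compact K \<and> totally_disconnected_set K \<and> perfect_subset K"

definition frobenius_norm :: "real^'n^'m \<Rightarrow> real" where
  "frobenius_norm A = sqrt (\<Sum>i\<in>UNIV. \<Sum>j\<in>UNIV. \<bar>A $ i $ j\<bar>\<^sup>2)"

end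

theory Submission
  imports Defs
begin

text \<open>
  A compact set avoiding, for each vector \<open>u\<close> of a basis, open slabs orthogonal to \<open>u\<close> around
  arbitrarily fine grids is totally disconnected. It has to meet \<open>x - T K\<^sub>1\<close> for all \<open>x\<close> in a ball and
  all \<open>T\<close> near \<open>T\<^sub>0\<close>. To leave a slab one moves from the current point of \<open>K\<^sub>1\<close> to one of two nearby
  points \<open>a\<close>, \<open>b\<close> whose values under \<open>u \<bullet> T\<close> differ by less than the grid spacing but by more than the
  slab width; later moves are so small that they do not lead back into the slab. The slab widths
  are chosen before \<open>x\<close> and \<open>T\<close>, so \<open>\<bar>u \<bullet> T (a - b)\<bar> \<ge> c \<bar>a - b\<bar>\<close> is needed with one \<open>c\<close> at all
  scales. A colouring argument provides this: on some piece of \<open>K\<^sub>1\<close> a single coordinate of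
  \<open>T\<^sub>0 (a - b)\<close> is comparable to \<open>\<bar>a - b\<bar>\<close> for pairs in every relatively open subset.
  The set found in this way need not be perfect. Passing to its condensation points removes only
  countably many points, which contribute to \<open>T K\<^sub>1 + K\<^sub>2\<close> a meagre set, so that by Baire's theorem the
  compact remainder still covers the ball.
\<close>

section \<open>Colouring pairs of points of a perfect set\<close>

text \<open>If every colour could be avoided inside every open set meeting \<open>K\<close>, then,
  the colours being finite in number, successive shrinking would give an open set meeting
  \<open>K\<close> without any coloured pair. That set would still contain two points of
  \<open>K\<close>, as \<open>K\<close> has no isolated points.\<close>

lemma monochromatic_pairs:
  fixes K :: "'a::metric_space set" and P :: "'i::finite \<Rightarrow> 'a \<Rightarrow> 'a \<Rightarrow> bool"
  assumes K: "compact K" "K \<noteq> {}" "\<And>x. x \<in> K \<Longrightarrow> x islimpt K"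
    and col: "\<And>a b. a \<in> K \<Longrightarrow> b \<in> K \<Longrightarrow> a \<noteq> b \<Longrightarrow> \<exists>i. P i a b"
  obtains i K' where "compact K'" "K' \<noteq> {}" "K' \<subseteq> K"
    "\<And>V. open V \<Longrightarrow> V \<inter> K' \<noteq> {} \<Longrightarrow> \<exists>a\<in>V \<inter> K'. \<exists>b\<in>V \<inter> K'. a \<noteq> b \<and> P i a b"
proof -
  define Q where "Q i V \<longleftrightarrow> (\<exists>a\<in>V \<inter> K. \<exists>b\<in>V \<inter> K. a \<noteq> b \<and> P i a b)" for i V
  have Q_mono: "Q i V" if "Q i U" "U \<subseteq> V" for i U V
    using that unfolding Q_def by blast
  have "\<exists>i U. open U \<and> U \<inter> K \<noteq> {} \<and> (\<forall>V. open V \<and> V \<subseteq> U \<and> V \<inter> K \<noteq> {} \<longrightarrow> Q i V)"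
  proof (rule ccontr)
    assume "\<not> ?thesis"
    then have *: "\<exists>V. open V \<and> V \<subseteq> U \<and> V \<inter> K \<noteq> {} \<and> \<not> Q i V"
      if "open U" "U \<inter> K \<noteq> {}" for U i
      using that by metis
    have "\<exists>V. open V \<and> V \<inter> K \<noteq> {} \<and> (\<forall>i\<in>J. \<not> Q i V)"
      if "finite J" for J :: "'i set"
      using that
    proof induction
      case empty
      show ?case using K(2) by (intro exI[of _ UNIV]) auto
    next
      case (insert j J)
      from insert.IH obtain U where U: "open U" "U \<inter> K \<noteq> {}" "\<forall>i\<in>J. \<not> Q i U"
        by (elim exE conjE)
      from *[OF U(1,2), of j] obtain V where V: "open V" "V \<subseteq> U" "V \<inter> K \<noteq> {}" "\<not> Q j V"
        by (elim exE conjE)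
      have "\<forall>i\<in>insert j J. \<not> Q i V" using U(3) V(2,4) Q_mono by (metis insert_iff)
      then show ?case using V(1,3) by (intro exI[of _ V] conjI)
    qed
    from this[OF finite[of UNIV]] obtain V where V: "open V" "V \<inter> K \<noteq> {}" "\<forall>i. \<not> Q i V" by auto
    obtain a where a: "a \<in> V \<inter> K" using V(2) by auto
    then obtain b where b: "b \<in> V \<inter> K" "b \<noteq> a"
      using islimptE[OF K(3)[of a], of V] V(1) by auto
    then obtain i where "P i a b" using col[of a b] a by auto
    then have "Q i V" unfolding Q_def using a b by metis
    then show False using V(3) by simp
  qed
  then obtain i U where U: "open U" "U \<inter> K \<noteq> {}"
    and V: "\<And>V. open V \<Longrightarrow> V \<subseteq> U \<Longrightarrow> V \<inter> K \<noteq> {} \<Longrightarrow> Q i V"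
    by metis
  show ?thesis
  \<comment> \<open>The closure restores compactness and costs nothing: an open set meeting it
    already meets \<open>U \<inter> K\<close>.\<close>
  proof (rule that[of "closure (U \<inter> K)" i])
    show sub: "closure (U \<inter> K) \<subseteq> K"
      using K(1) by (simp add: closure_minimal compact_imp_closed)
    show "compact (closure (U \<inter> K))"
      using K(1) sub by (metis closed_closure compact_Int_closed inf.absorb_iff2)
    show "closure (U \<inter> K) \<noteq> {}" using U(2) by simp
    fix W :: "'a set" assume W: "open W" "W \<inter> closure (U \<inter> K) \<noteq> {}"
    then have "(W \<inter> U) \<inter> K \<noteq> {}"
      using open_Int_closure_eq_empty[of W "U \<inter> K"] by (simp add: Int_assoc)
    then show "\<exists>a\<in>W \<inter> closure (U \<inter> K). \<exists>b\<in>W \<inter> closure (U \<inter> K). a \<noteq> b \<and> P i a b"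
      using V[of "W \<inter> U"] W(1) U(1) closure_subset[of "U \<inter> K"] unfolding Q_def by blast
  qed
qed

section \<open>Avoiding grids by small moves\<close>

text \<open>The two points of a separated pair cannot both have values near the grid: near the same
  grid point they would be too close in value, near different ones too far apart. By compactness
  finitely many pairs serve all starting points, so one \<delta> works for every parameter and every
  shift.\<close>

lemma grid_avoidance_step:
  fixes K :: "'a::metric_space set" and f :: "'p \<Rightarrow> 'a \<Rightarrow> real"
  assumes K: "compact K" and L: "L > 0" and c: "c > 0" and r: "r > 0"
    and lip: "\<And>p a b. p \<in> \<Theta> \<Longrightarrow> \<bar>f p a - f p b\<bar> \<le> L * dist a b"
    and sep: "\<And>V. open V \<Longrightarrow> V \<inter> K \<noteq> {} \<Longrightarrow>
      \<exists>a\<in>V \<inter> K. \<exists>b\<in>V \<inter> K. a \<noteq> b \<and> (\<forall>p\<in>\<Theta>. c * dist a b \<le> \<bar>f p a - f p b\<bar>)"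
  shows "\<exists>s \<delta>. 0 < s \<and> s < r \<and> 0 < \<delta> \<and> (\<forall>p\<in>\<Theta>. \<forall>t. \<forall>a\<in>K. \<exists>b\<in>K. dist a b < r \<and>
    (\<forall>z::int. \<delta> \<le> \<bar>t - f p b - s * of_int z\<bar>))"
proof -
  \<comment> \<open>Two points in one ball of radius \<rho> are within reach \<open>r\<close> of
    each other, and their values differ by at most \<open>r/4\<close>, half the grid spacing
    \<open>r/2\<close> used below.\<close>
  define \<rho> where "\<rho> = min (r/2) (r/(8*L))"
  have \<rho>: "\<rho> > 0" "2 * \<rho> \<le> r" "L * (2 * \<rho>) \<le> r/4"
  proof -
    show "\<rho> > 0" "2 * \<rho> \<le> r" using L r by (auto simp: \<rho>_def)
    have "L * \<rho> \<le> L * (r/(8*L))" using L by (intro mult_left_mono) (auto simp: \<rho>_def)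
    then show "L * (2 * \<rho>) \<le> r/4" using L by simp
  qed
  obtain F where F: "finite F" "F \<subseteq> K" "K \<subseteq> (\<Union>x\<in>F. ball x \<rho>)"
    by (rule compactE_image[OF K, of K "\<lambda>x. ball x \<rho>"]) (use \<rho>(1) in auto)
  define R where "R a b \<longleftrightarrow> a \<noteq> b \<and> (\<forall>p\<in>\<Theta>. c * dist a b \<le> \<bar>f p a - f p b\<bar>)" for a b
  have "\<exists>a b. a \<in> ball x \<rho> \<inter> K \<and> b \<in> ball x \<rho> \<inter> K \<and> R a b" if "x \<in> F" for x
  proof -
    have "x \<in> ball x \<rho> \<inter> K" using that F(2) \<rho>(1) by auto
    then have "ball x \<rho> \<inter> K \<noteq> {}" by blast
    from sep[OF open_ball this] show ?thesis unfolding R_def[symmetric] by blast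
  qed
  then obtain A B where AB: "\<And>x. x \<in> F \<Longrightarrow> A x \<in> ball x \<rho> \<inter> K \<and> B x \<in> ball x \<rho> \<inter> K \<and> R (A x) (B x)"
    by metis
  \<comment> \<open>The inserted 1 keeps \<open>Min\<close> meaningful should \<open>F\<close> be
    empty.\<close>
  define \<alpha> where "\<alpha> = Min (insert 1 ((\<lambda>x. dist (A x) (B x)) ` F))"
  have \<alpha>: "\<alpha> > 0" using AB F(1) by (auto simp: \<alpha>_def R_def)
  have \<alpha>_le: "\<alpha> \<le> dist (A x) (B x)" if "x \<in> F" for x
    using that F(1) by (auto simp: \<alpha>_def)
  \<comment> \<open>The first bound excludes that both points lie near the same grid point. The
    second excludes different ones, since \<open>r/4 + 2 * \<delta>\<close> does not exceed the
    spacing \<open>r/2\<close>.\<close>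
  define \<delta> where "\<delta> = min (c * \<alpha> / 2) (r/8)"
  have \<delta>: "\<delta> > 0" "2 * \<delta> \<le> c * \<alpha>" "2 * \<delta> \<le> r/4" using c \<alpha> r by (auto simp: \<delta>_def)
  have "\<exists>b\<in>K. dist a b < r \<and> (\<forall>z::int. \<delta> \<le> \<bar>t - f p b - r/2 * of_int z\<bar>)"
    if p: "p \<in> \<Theta>" and a: "a \<in> K" for p t a
  proof (rule ccontr)
    assume no: "\<not> ?thesis"
    obtain x where x: "x \<in> F" "dist x a < \<rho>" using F(3) a by auto
    have ab: "dist x (A x) < \<rho>" "dist x (B x) < \<rho>" "A x \<in> K" "B x \<in> K"
      and low: "c * dist (A x) (B x) \<le> \<bar>f p (A x) - f p (B x)\<bar>"
      using AB[OF x(1)] p by (auto simp: R_def)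
    have "dist a (A x) < r" "dist a (B x) < r"
      using x(2) ab(1,2) \<rho>(2) dist_triangle[of a "A x" x] dist_triangle[of a "B x" x]
      by (auto simp: dist_commute)
    then obtain z z' :: int where z: "\<bar>t - f p (A x) - r/2 * of_int z\<bar> < \<delta>"
      and z': "\<bar>t - f p (B x) - r/2 * of_int z'\<bar> < \<delta>"
      using no ab(3,4) by (meson not_le)
    have "dist (A x) (B x) \<le> 2 * \<rho>"
      using ab(1,2) dist_triangle3[of "A x" "B x" x] by simp
    then have "L * dist (A x) (B x) \<le> r/4"
      using \<rho>(3) L by (meson mult_left_mono less_imp_le order_trans)
    then have up: "\<bar>f p (A x) - f p (B x)\<bar> \<le> r/4"
      using lip[OF p, of "A x" "B x"] by linarith
    have "c * \<alpha> \<le> c * dist (A x) (B x)" using \<alpha>_le[OF x(1)] c by simp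
    then have low': "2 * \<delta> \<le> \<bar>f p (A x) - f p (B x)\<bar>" using low \<delta>(2) by linarith
    show False
    proof (cases "z = z'")
      case True
      then show False using z z' low' unfolding True by linarith
    next
      case False
      then have "1 \<le> \<bar>real_of_int (z' - z)\<bar>" by linarith
      then have "r/2 * 1 \<le> r/2 * \<bar>real_of_int (z' - z)\<bar>" using r by (intro mult_left_mono) auto
      also have "\<dots> = \<bar>r/2 * real_of_int (z' - z)\<bar>" using r by (simp add: abs_mult)
      also have "\<dots> = \<bar>r/2 * of_int z' - r/2 * of_int z\<bar>"
        by (simp only: of_int_diff right_diff_distrib)
      finally show False using z z' up \<delta>(3) by linarith
    qed
  qed
  then show ?thesis
    using r \<delta>(1) by (intro exI[of _ "r/2"] exI[of _ \<delta>]) auto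
qed

text \<open>Iterating the step gives a Cauchy sequence in \<open>K\<close>. The radii are fixed in
  advance, independently of \<open>p\<close> and \<open>t\<close>, and shrink so fast that all moves
  after step \<open>n\<close> together use up at most half of the clearance won at that step; the
  limit point keeps the other half for every \<open>n\<close>.\<close>

lemma grid_avoidance:
  fixes K :: "'a::metric_space set" and f :: "'i \<Rightarrow> 'p \<Rightarrow> 'a \<Rightarrow> real" and h :: "nat \<Rightarrow> 'i"
  assumes K: "compact K" "K \<noteq> {}" and L: "L > 0" and c: "c > 0"
    and lip: "\<And>i p a b. p \<in> \<Theta> \<Longrightarrow> \<bar>f i p a - f i p b\<bar> \<le> L * dist a b"
    and sep: "\<And>i V. open V \<Longrightarrow> V \<inter> K \<noteq> {} \<Longrightarrow>
      \<exists>a\<in>V \<inter> K. \<exists>b\<in>V \<inter> K. a \<noteq> b \<and> (\<forall>p\<in>\<Theta>. c * dist a b \<le> \<bar>f i p a - f i p b\<bar>)"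
  obtains s \<delta> :: "nat \<Rightarrow> real" where "\<And>n. 0 < s n" "\<And>n. s n \<le> (1/2)^n" "\<And>n. 0 < \<delta> n"
    "\<And>p t. p \<in> \<Theta> \<Longrightarrow> \<exists>a\<in>K. \<forall>n. \<forall>z::int. \<delta> n \<le> \<bar>t (h n) - f (h n) p a - s n * of_int z\<bar>"
proof -
  have "\<forall>i r. \<exists>s \<delta>. r > 0 \<longrightarrow> 0 < s \<and> s < r \<and> 0 < \<delta> \<and> (\<forall>p\<in>\<Theta>. \<forall>t. \<forall>a\<in>K. \<exists>b\<in>K. dist a b < r \<and>
      (\<forall>z::int. \<delta> \<le> \<bar>t - f i p b - s * of_int z\<bar>))"
    using grid_avoidance_step[OF K(1) L c _ lip sep] by blast
  then obtain S D where SD: "\<And>i r. r > 0 \<Longrightarrow> 0 < S i r \<and> S i r < r \<and> 0 < D i r \<and>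
      (\<forall>p\<in>\<Theta>. \<forall>t. \<forall>a\<in>K. \<exists>b\<in>K. dist a b < r \<and> (\<forall>z::int. D i r \<le> \<bar>t - f i p b - S i r * of_int z\<bar>))"
    by metis
  \<comment> \<open>Halving bounds the sum of all later radii by twice the first of them; the other
    bound makes this total, multiplied by \<open>L\<close>, at most half of the current
    clearance.\<close>
  define r where "r = rec_nat 1 (\<lambda>n r. min (r/2) (D (h n) r / (4*L)))"
  have r0: "r 0 = 1" and rS: "r (Suc n) = min (r n/2) (D (h n) (r n) / (4*L))" for n
    by (simp_all add: r_def)
  have rpos: "r n > 0" for n
    by (induction n) (use SD L in \<open>auto simp: r0 rS\<close>)
  have rhalf: "2 * r (Suc n) \<le> r n" for n by (simp add: rS)
  have rle: "r n \<le> (1/2)^n" for n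
  proof (induction n)
    case (Suc n)
    then show ?case using rhalf[of n] by simp
  qed (simp add: r0)
  define s where "s n = S (h n) (r n)" for n
  define d where "d n = D (h n) (r n)" for n
  have step: "0 < s n" "s n < r n" "0 < d n" for n
    using SD[OF rpos] by (auto simp: s_def d_def)
  have Lr: "L * (2 * r (Suc n)) \<le> d n / 2" for n
  proof -
    have "L * r (Suc n) \<le> L * (d n / (4*L))"
      using L by (intro mult_left_mono) (auto simp: rS d_def)
    then show ?thesis using L by simp
  qed
  show ?thesis
  proof (rule that[of s "\<lambda>n. d n / 2"])
    show "0 < s n" "s n \<le> (1/2)^n" "0 < d n / 2" for n
      using step[of n] rle[of n] by auto
    fix p and t :: "'i \<Rightarrow> real" assume p: "p \<in> \<Theta>"
    have "\<exists>b. \<forall>n. b n \<in> K \<and> (dist (b n) (b (Suc n)) < r n \<and>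
        (\<forall>z::int. d n \<le> \<bar>t (h n) - f (h n) p (b (Suc n)) - s n * of_int z\<bar>))"
    proof (rule dependent_nat_choice)
      show "\<exists>x. x \<in> K" using K(2) by auto
      fix x n assume "x \<in> K"
      then show "\<exists>y. y \<in> K \<and> dist x y < r n \<and> (\<forall>z::int. d n \<le> \<bar>t (h n) - f (h n) p y - s n * of_int z\<bar>)"
        using SD[OF rpos[of n], of "h n"] p unfolding s_def d_def by blast
    qed
    then obtain b where b: "\<And>n. b n \<in> K" "\<And>n. dist (b n) (b (Suc n)) < r n"
      "\<And>n (z::int). d n \<le> \<bar>t (h n) - f (h n) p (b (Suc n)) - s n * of_int z\<bar>" by blast
    \<comment> \<open>Halving gives \<open>r n \<le> 2 * r n - 2 * r (Suc n)\<close>, so the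
      distances telescope.\<close>
    have tail: "dist (b m) (b (m + k)) \<le> 2 * r m - 2 * r (m + k)" for m k
    proof (induction k)
      case (Suc k)
      then show ?case
        using b(2)[of "m + k"] rhalf[of "m + k"] dist_triangle[of "b m" "b (Suc (m + k))" "b (m + k)"]
        by simp
    qed simp
    obtain l \<phi> where l: "l \<in> K" "strict_mono \<phi>" "(b \<circ> \<phi>) \<longlonglongrightarrow> l"
      using K(1) b(1) unfolding compact_def by metis
    have near: "dist (b m) l \<le> 2 * r m" for m
    proof (rule LIMSEQ_le_const2)
      show "(\<lambda>n. dist (b m) ((b \<circ> \<phi>) n)) \<longlonglongrightarrow> dist (b m) l"
        by (intro tendsto_intros l(3))
      have "dist (b m) (b (\<phi> n)) \<le> 2 * r m" if "n \<ge> m" for n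
      proof -
        have "\<phi> n \<ge> m" using seq_suble[OF l(2), of n] that by simp
        then show ?thesis using tail[of m "\<phi> n - m"] rpos[of "\<phi> n"] by simp
      qed
      then show "\<exists>N. \<forall>n\<ge>N. dist (b m) ((b \<circ> \<phi>) n) \<le> 2 * r m" by auto
    qed
    show "\<exists>a\<in>K. \<forall>n. \<forall>z::int. d n / 2 \<le> \<bar>t (h n) - f (h n) p a - s n * of_int z\<bar>"
    proof (intro bexI allI)
      fix n and z :: int
      have "\<bar>f (h n) p (b (Suc n)) - f (h n) p l\<bar> \<le> L * dist (b (Suc n)) l" by (rule lip[OF p])
      also have "\<dots> \<le> L * (2 * r (Suc n))" using near L by simp
      also have "\<dots> \<le> d n / 2" by (rule Lr)
      finally show "d n / 2 \<le> \<bar>t (h n) - f (h n) p l - s n * of_int z\<bar>"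
        using b(3)[of n z] by linarith
    qed (rule l(1))
  qed
qed

section \<open>Total disconnectedness, perfect parts and Baire category\<close>

lemma totally_disconnected_set_iff:
  "totally_disconnected_set S \<longleftrightarrow> (\<forall>C x y. C \<subseteq> S \<and> connected C \<and> x \<in> C \<and> y \<in> C \<longrightarrow> x = y)"
proof
  assume "totally_disconnected_set S"
  then show "\<forall>C x y. C \<subseteq> S \<and> connected C \<and> x \<in> C \<and> y \<in> C \<longrightarrow> x = y"
    unfolding totally_disconnected_set_def
    by (metis connected_component_maximal singletonD subset_eq)
next
  assume R: "\<forall>C x y. C \<subseteq> S \<and> connected C \<and> x \<in> C \<and> y \<in> C \<longrightarrow> x = y"
  show "totally_disconnected_set S"
    unfolding totally_disconnected_set_def
  proof
    fix x assume x: "x \<in> S"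
    then have "x \<in> connected_component_set S x" by simp
    then show "connected_component_set S x = {x}"
      using R connected_component_subset[of S x] connected_connected_component[of S x] by blast
  qed
qed

lemma totally_disconnected_set_subset:
  "totally_disconnected_set S \<Longrightarrow> T \<subseteq> S \<Longrightarrow> totally_disconnected_set T"
  unfolding totally_disconnected_set_iff by blast

lemma totally_disconnected_set_interior:
  fixes S :: "'a::euclidean_space set"
  assumes "totally_disconnected_set S"
  shows "interior S = {}"
proof (rule ccontr)
  assume "interior S \<noteq> {}"
  then obtain x e where e: "e > 0" "ball x e \<subseteq> S" by (auto simp: mem_interior)
  obtain b :: 'a where b: "b \<in> Basis" by (meson nonempty_Basis ex_in_conv)
  have "x \<in> ball x e" "x + (e/2) *\<^sub>R b \<in> ball x e" using e(1) b by (auto simp: dist_norm)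
  then have "x = x + (e/2) *\<^sub>R b"
    using assms e(2) connected_ball unfolding totally_disconnected_set_iff by blast
  then show False using e(1) b by auto
qed

text \<open>Cantor--Bendixson: the perfect part consists of the condensation points.\<close>

lemma compact_eq_perfect_Un_countable:
  fixes K :: "'a::{second_countable_topology,t2_space} set"
  assumes K: "compact K"
  obtains P where "compact P" "perfect_subset P" "P \<subseteq> K" "countable (K - P)"
proof -
  define P where "P = {x\<in>K. \<forall>U. open U \<and> x \<in> U \<longrightarrow> uncountable (U \<inter> K)}"
  obtain \<B> :: "'a set set" where \<B>: "countable \<B>" "\<And>C. C \<in> \<B> \<Longrightarrow> open C"
       "\<And>S. open S \<Longrightarrow> \<exists>U. U \<subseteq> \<B> \<and> S = \<Union>U"
    using univ_second_countable by blast
  have "K - P \<subseteq> (\<Union>B\<in>{B\<in>\<B>. countable (B \<inter> K)}. B \<inter> K)"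
  proof
    fix x assume x: "x \<in> K - P"
    then obtain U where U: "open U" "x \<in> U" "countable (U \<inter> K)" by (auto simp: P_def)
    then obtain B where B: "B \<in> \<B>" "x \<in> B" "B \<subseteq> U" using \<B>(3)[OF U(1)] by auto
    then have "countable (B \<inter> K)" using U(3) by (meson Int_mono countable_subset order_refl)
    then show "x \<in> (\<Union>B\<in>{B\<in>\<B>. countable (B \<inter> K)}. B \<inter> K)" using x B by auto
  qed
  then have cnt: "countable (K - P)"
    by (rule countable_subset) (rule countable_UN, use \<B>(1) in auto)
  have "K - P = K \<inter> \<Union>{U. open U \<and> countable (U \<inter> K)}" by (auto simp: P_def)
  then have "P = K - \<Union>{U. open U \<and> countable (U \<inter> K)}" by (auto simp: P_def)
  then have cP: "compact P"
    using compact_diff[OF K, of "\<Union>{U. open U \<and> countable (U \<inter> K)}"] by auto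
  show ?thesis
  proof
    show "compact P" by fact
    show "P \<subseteq> K" by (auto simp: P_def)
    show "countable (K - P)" by fact
    have "x islimpt P" if x: "x \<in> P" for x
    proof (rule islimptI)
      fix T assume T: "x \<in> T" "open T"
      then have "uncountable (T \<inter> K)" using x by (auto simp: P_def)
      \<comment> \<open>Only countably many points of \<open>K\<close> are lost in \<open>P\<close>,
        so neighbourhoods remain uncountable within \<open>P\<close>.\<close>
      moreover have "T \<inter> K \<subseteq> (K - P) \<union> (T \<inter> P)" by auto
      ultimately have "uncountable (T \<inter> P)"
        using cnt by (meson countable_Un countable_subset)
      then have "\<not> T \<inter> P \<subseteq> {x}" by (meson countable_empty countable_insert countable_subset)
      then show "\<exists>y\<in>P. y \<in> T \<and> y \<noteq> x" by auto
    qed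
    then show "perfect_subset P"
      using compact_imp_closed[OF cP] by (auto simp: perfect_subset_def)
  qed
qed

text \<open>The part \<open>A + Q\<close> is a countable union of closed translates with empty
  interior, so by Baire's theorem its complement is dense. The points of \<open>U\<close> in this
  complement lie in \<open>A + P\<close>, which is compact and hence contains their closure, thus
  all of \<open>U\<close>.\<close>

lemma subset_set_plus_Un_countable:
  fixes A P Q U :: "'a::euclidean_space set"
  assumes A: "compact A" "interior A = {}" and P: "compact P" and Q: "countable Q"
    and U: "open U" "U \<subseteq> A + (P \<union> Q)"
  shows "U \<subseteq> A + P"
proof -
  define \<G> where "\<G> = (\<lambda>q. - ((+) q ` A)) ` Q"
  have "UNIV \<subseteq> closure (\<Inter>\<G>)"
  proof (rule Baire)
    show "countable \<G>" using Q by (simp add: \<G>_def)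
    fix T assume "T \<in> \<G>"
    then obtain q where T: "T = - ((+) q ` A)" by (auto simp: \<G>_def)
    have "closed ((+) q ` A)" using A(1) by (simp add: compact_imp_closed compact_translation)
    moreover have "interior ((+) q ` A) = {}" using A(2) by (simp add: interior_translation)
    ultimately show "openin (top_of_set UNIV) T \<and> UNIV \<subseteq> closure T"
      by (simp add: T closure_complement open_Compl)
  qed auto
  then have "U \<subseteq> closure (U \<inter> \<Inter>\<G>)"
    using open_Int_closure_subset[OF U(1), of "\<Inter>\<G>"] by auto
  also have "\<dots> \<subseteq> closure (A + P)"
  proof (rule closure_mono, rule subsetI)
    fix x assume x: "x \<in> U \<inter> \<Inter>\<G>"
    then obtain a y where ay: "x = a + y" "a \<in> A" "y \<in> P \<union> Q" using U(2) by (meson IntD1 set_plus_elim subsetD)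
    have "y \<notin> Q" using x ay(1,2) by (auto simp: \<G>_def add.commute)
    then show "x \<in> A + P" using ay by auto
  qed
  also have "\<dots> = A + P"
    using compact_imp_closed[OF compact_sums[OF A(1) P]]
    by (simp add: set_plus_def Bex_def conj_ac)
  finally show ?thesis .
qed

text \<open>Two distinct points differ under some \<open>u i\<close>, and some grid in that
  direction is finer than the difference. One of its hyperplanes then separates them, and a
  connected set containing both would have to cross it.\<close>

lemma grid_complement_totally_disconnected:
  fixes u :: "'i \<Rightarrow> 'a::real_inner" and h :: "nat \<Rightarrow> 'i" and s \<delta> :: "nat \<Rightarrow> real"
  assumes s: "\<And>n. 0 < s n" "s \<longlonglongrightarrow> 0" and \<delta>: "\<And>n. 0 < \<delta> n"
    and h: "\<And>i. \<exists>\<^sub>\<infinity>n. h n = i" and u: "\<And>w. w \<noteq> 0 \<Longrightarrow> \<exists>i. u i \<bullet> w \<noteq> 0"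
  shows "totally_disconnected_set {y. \<forall>n. \<forall>z::int. \<delta> n \<le> \<bar>u (h n) \<bullet> y - s n * of_int z\<bar>}"
  unfolding totally_disconnected_set_iff
proof (intro allI impI, elim conjE)
  fix C x y
  assume C: "C \<subseteq> {y. \<forall>n. \<forall>z::int. \<delta> n \<le> \<bar>u (h n) \<bullet> y - s n * of_int z\<bar>}" "connected C"
    and xy: "x \<in> C" "y \<in> C"
  have False if xy': "x \<in> C" "y \<in> C" "u i \<bullet> x < u i \<bullet> y" for i x y
  proof -
    have "eventually (\<lambda>n. s n < u i \<bullet> y - u i \<bullet> x) sequentially"
      using s(2) xy'(3) by (intro order_tendstoD) auto
    with h[of i] have "\<exists>\<^sub>\<infinity>n. h n = i \<and> s n < u i \<bullet> y - u i \<bullet> x"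
      by (simp add: cofinite_eq_sequentially frequently_eventually_frequently)
    then obtain n where n: "h n = i" "s n < u i \<bullet> y - u i \<bullet> x"
      by (metis (mono_tags, lifting) frequently_ex)
    define z where "z = \<lceil>u i \<bullet> x / s n\<rceil>"
    have "u i \<bullet> x / s n \<le> of_int z" "of_int z < u i \<bullet> x / s n + 1"
      unfolding z_def by linarith+
    then have z: "u i \<bullet> x \<le> s n * of_int z" "s n * of_int z \<le> u i \<bullet> x + s n"
      using s(1)[of n] by (simp_all add: field_simps)
    have "connected ((\<lambda>y. u i \<bullet> y) ` C)"
      by (intro connected_continuous_image continuous_intros C(2))
    then have "s n * of_int z \<in> (\<lambda>y. u i \<bullet> y) ` C"
      unfolding connected_iff_interval
      using z n(2) imageI[OF xy'(1), of "\<lambda>y. u i \<bullet> y"] imageI[OF xy'(2), of "\<lambda>y. u i \<bullet> y"]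
      by (smt (verit))
    then obtain w where "w \<in> C" "u i \<bullet> w = s n * of_int z" by auto
    then have "\<delta> n \<le> \<bar>u (h n) \<bullet> w - s n * of_int z\<bar>" using C(1) by blast
    then have "\<delta> n \<le> 0" using n(1) \<open>u i \<bullet> w = s n * of_int z\<close> by simp
    then show False using \<delta>[of n] by simp
  qed
  then have "u i \<bullet> (x - y) = 0" for i
    using xy by (metis eq_iff_diff_eq_0 inner_diff_right linorder_neqE_linordered_idom)
  then show "x = y" using u[of "x - y"] by auto
qed

section \<open>Matrix norms, recurring indices and large coordinates\<close>

lemma frobenius_norm_eq_norm: "frobenius_norm A = norm A"
  by (simp add: frobenius_norm_def norm_vec_def L2_set_def sum_nonneg)

lemma norm_matrix_vector_mult_le:
  fixes A :: "real^'n^'m"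
  shows "norm (A *v x) \<le> norm A * norm x"
proof -
  have "norm (A *v x) \<le> L2_set (\<lambda>i. norm (A $ i) * norm x) UNIV"
    unfolding norm_vec_def[of "A *v x"]
    by (intro L2_set_mono) (auto simp: matrix_vector_mul_component Cauchy_Schwarz_ineq2)
  also have "\<dots> = norm A * norm x"
    by (simp add: norm_vec_def[of A] L2_set_left_distrib)
  finally show ?thesis .
qed

text \<open>Reading off the first component of a decoded pair repeats each index infinitely often.
  This lets every direction receive arbitrarily fine grids.\<close>

lemma ex_sequence_hitting_infinitely_often:
  obtains h :: "nat \<Rightarrow> 'i::finite" where "\<And>i. \<exists>\<^sub>\<infinity>n. h n = i"
proof -
  obtain n :: nat and g :: "nat \<Rightarrow> 'i" where g: "UNIV = g ` {i. i < n}"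
    using finite_imp_nat_seg_image_inj_on[OF finite[of "UNIV :: 'i set"]] by metis
  show ?thesis
  proof
    fix i
    obtain m where m: "g m = i" using g by (metis UNIV_I imageE)
    have "infinite (range (\<lambda>k. prod_encode (m, k)))"
      by (intro range_inj_infinite injI) (auto dest: injD[OF inj_prod_encode])
    moreover have "range (\<lambda>k. prod_encode (m, k)) \<subseteq> {n. g (fst (prod_decode n)) = i}"
      using m by auto
    ultimately show "\<exists>\<^sub>\<infinity>n. g (fst (prod_decode n)) = i"
      unfolding frequently_cofinite using finite_subset by auto
  qed
qed

lemma ex_coordinate_ge:
  fixes v :: "real^'n"
  shows "\<exists>i. norm v / CARD('n) \<le> \<bar>v $ i\<bar>"
proof (rule ccontr)
  assume "\<not> ?thesis"
  then have "(\<Sum>i\<in>UNIV. \<bar>v $ i\<bar>) < (\<Sum>i\<in>(UNIV::'n set). norm v / CARD('n))"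
    by (intro sum_strict_mono) (auto simp: not_le)
  then show False using norm_le_l1_cart[of v] by simp
qed

section \<open>Construction of the second Cantor set\<close>

theorem corollary1p2:
  fixes K\<^sub>1 :: "(real^'d) set" and T\<^sub>0 :: "real^'d^'d"
  assumes "cantor_set K\<^sub>1"
    and "invertible T\<^sub>0"
  shows "\<exists>(K\<^sub>2 :: (real^'d) set) (\<epsilon>::real). cantor_set K\<^sub>2 \<and> \<epsilon> > 0 \<and>
    interior (\<Inter>T\<in>{T :: real^'d^'d. invertible T \<and> frobenius_norm (T - T\<^sub>0) < \<epsilon>}.
      ((*v) T) ` K\<^sub>1 + K\<^sub>2) \<noteq> {}"
proof -
  have K1: "K\<^sub>1 \<noteq> {}" "compact K\<^sub>1" "totally_disconnected_set K\<^sub>1" "\<And>x. x \<in> K\<^sub>1 \<Longrightarrow> x islimpt K\<^sub>1"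
    using assms(1) by (auto simp: cantor_set_def perfect_subset_def)
  have "inj ((*v) T\<^sub>0)"
    using assms(2) by (simp add: inj_matrix_vector_mult)
  then obtain m where m: "m > 0" "\<And>v. m * norm v \<le> norm (T\<^sub>0 *v v)"
    by (metis linear_inj_bounded_below_pos matrix_vector_mul_linear)
  define \<kappa> where "\<kappa> = m / CARD('d)"
  have \<kappa>: "\<kappa> > 0" using m(1) by (simp add: \<kappa>_def)
  have "\<exists>j. \<kappa> * dist a b \<le> \<bar>(T\<^sub>0 *v (a - b)) $ j\<bar>" for a b
  proof -
    obtain j where j: "norm (T\<^sub>0 *v (a - b)) / CARD('d) \<le> \<bar>(T\<^sub>0 *v (a - b)) $ j\<bar>"
      using ex_coordinate_ge by blast
    have "\<kappa> * dist a b \<le> norm (T\<^sub>0 *v (a - b)) / CARD('d)"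
      using m(2)[of "a - b"] by (simp add: \<kappa>_def dist_norm divide_right_mono)
    with j show ?thesis by (intro exI[of _ j]) simp
  qed
  \<comment> \<open>The colours are the coordinates: each pair has a coordinate carrying at least
    the fraction \<open>1 / CARD('d)\<close> of the norm of its image.\<close>
  then obtain j K where K: "compact K" "K \<noteq> {}" "K \<subseteq> K\<^sub>1"
    and pairs: "\<And>V. open V \<Longrightarrow> V \<inter> K \<noteq> {} \<Longrightarrow>
      \<exists>a\<in>V \<inter> K. \<exists>b\<in>V \<inter> K. a \<noteq> b \<and> \<kappa> * dist a b \<le> \<bar>(T\<^sub>0 *v (a - b)) $ j\<bar>"
    using monochromatic_pairs[OF K1(2,1,4), of "\<lambda>j a b. \<kappa> * dist a b \<le> \<bar>(T\<^sub>0 *v (a - b)) $ j\<bar>"]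
    by metis
  define N where "N = norm T\<^sub>0 + 1"
  have N: "N > 0" unfolding N_def by (simp add: add_nonneg_pos)
  \<comment> \<open>Replacing \<open>T\<^sub>0\<close> by \<open>T\<close> and adding the tilt
    \<eta> each cost at most \<kappa>/4 of the separation constant, which leaves \<kappa>/2. The
    bound 1 on \<epsilon> makes \<open>N\<close> a norm bound for all admissible
    \<open>T\<close>.\<close>
  define \<epsilon> where "\<epsilon> = min 1 (\<kappa>/4)"
  define \<eta> where "\<eta> = \<kappa> / (4 * N)"
  have \<epsilon>: "\<epsilon> > 0" "\<epsilon> \<le> 1" "\<epsilon> \<le> \<kappa>/4" and \<eta>: "\<eta> > 0" "\<eta> * N = \<kappa>/4"
    using \<kappa> N by (auto simp: \<epsilon>_def \<eta>_def)
  \<comment> \<open>These vectors span, yet all are so close to the single axis \<open>j\<close> that they inherit its separation of pairs.\<close>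
  define u :: "'d \<Rightarrow> real^'d" where "u i = axis j 1 + \<eta> *\<^sub>R axis i 1" for i
  have u: "u i \<bullet> w = w $ j + \<eta> * w $ i" for i w
    by (simp add: u_def inner_add_left inner_axis' )
  define \<Theta> where "\<Theta> = {T :: real^'d^'d. norm (T - T\<^sub>0) < \<epsilon>}"
  have normT: "norm (T *v v) \<le> N * norm v" if "T \<in> \<Theta>" for T v
  proof -
    have "norm T \<le> N"
      using that norm_triangle_ineq2[of T T\<^sub>0] \<epsilon>(2) by (simp add: \<Theta>_def N_def)
    then show ?thesis
      using norm_matrix_vector_mult_le[of T v] by (meson mult_right_mono norm_ge_zero order_trans)
  qed
  have diff: "u i \<bullet> (T *v a) - u i \<bullet> (T *v b) = u i \<bullet> (T *v (a - b))" for i T a b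
    by (simp add: inner_diff_right matrix_vector_mult_diff_distrib)
  have lip: "\<bar>u i \<bullet> (T *v a) - u i \<bullet> (T *v b)\<bar> \<le> (1 + \<eta>) * N * dist a b" if T: "T \<in> \<Theta>" for i T a b
  proof -
    have "norm (u i) \<le> norm (axis j (1::real) :: real^'d) + norm (\<eta> *\<^sub>R axis i (1::real) :: real^'d)"
      unfolding u_def by (rule norm_triangle_ineq)
    then have "norm (u i) \<le> 1 + \<eta>"
      using \<eta>(1) by simp
    then have "norm (u i) * norm (T *v (a - b)) \<le> (1 + \<eta>) * (N * norm (a - b))"
      using normT[OF T] \<eta>(1) by (intro mult_mono) auto
    then show ?thesis
      using Cauchy_Schwarz_ineq2[of "u i" "T *v (a - b)"] by (simp add: diff dist_norm)
  qed
  have sep: "\<exists>a\<in>V \<inter> K. \<exists>b\<in>V \<inter> K. a \<noteq> b \<and>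
      (\<forall>T\<in>\<Theta>. \<kappa>/2 * dist a b \<le> \<bar>u i \<bullet> (T *v a) - u i \<bullet> (T *v b)\<bar>)"
    if V: "open V" "V \<inter> K \<noteq> {}" for i V
  proof -
    obtain a b where ab: "a \<in> V \<inter> K" "b \<in> V \<inter> K" "a \<noteq> b"
      and far: "\<kappa> * dist a b \<le> \<bar>(T\<^sub>0 *v (a - b)) $ j\<bar>"
      using pairs[OF V] by blast
    have "\<kappa>/2 * dist a b \<le> \<bar>u i \<bullet> (T *v a) - u i \<bullet> (T *v b)\<bar>" if T: "T \<in> \<Theta>" for T
    proof -
      let ?v = "a - b"
      have "\<bar>(T *v ?v) $ j - (T\<^sub>0 *v ?v) $ j\<bar> \<le> norm ((T - T\<^sub>0) *v ?v)"
        using component_le_norm_cart[of "(T - T\<^sub>0) *v ?v" j] by (simp add: matrix_vector_mult_diff_rdistrib)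
      also have "\<dots> \<le> norm (T - T\<^sub>0) * norm ?v" by (rule norm_matrix_vector_mult_le)
      also have "\<dots> \<le> \<kappa>/4 * dist a b"
        unfolding dist_norm using T \<epsilon>(3) by (intro mult_right_mono) (auto simp: \<Theta>_def)
      finally have 1: "\<bar>(T *v ?v) $ j - (T\<^sub>0 *v ?v) $ j\<bar> \<le> \<kappa>/4 * dist a b" .
      have "\<bar>(T *v ?v) $ i\<bar> \<le> N * norm ?v"
        using component_le_norm_cart[of "T *v ?v" i] normT[OF T, of ?v] by linarith
      then have "\<eta> * \<bar>(T *v ?v) $ i\<bar> \<le> \<eta> * (N * norm ?v)" using \<eta>(1) by simp
      also have "\<dots> = \<kappa>/4 * dist a b" using \<eta>(2) by (simp add: dist_norm flip: mult.assoc)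
      finally have "\<bar>\<eta> * (T *v ?v) $ i\<bar> \<le> \<kappa>/4 * dist a b" using \<eta>(1) by (simp add: abs_mult)
      with 1 far have "\<kappa>/2 * dist a b \<le> \<bar>(T *v ?v) $ j + \<eta> * (T *v ?v) $ i\<bar>" by argo
      then show ?thesis unfolding diff u[of i "T *v ?v"] .
    qed
    then show ?thesis using ab by blast
  qed
  obtain h :: "nat \<Rightarrow> 'd" where h: "\<And>i. \<exists>\<^sub>\<infinity>n. h n = i"
    using ex_sequence_hitting_infinitely_often by blast
  have "(1 + \<eta>) * N > 0" "\<kappa>/2 > 0" using \<eta>(1) N \<kappa> by auto
  then obtain s \<delta> :: "nat \<Rightarrow> real" where s: "\<And>n. 0 < s n" "\<And>n. s n \<le> (1/2)^n" and \<delta>: "\<And>n. 0 < \<delta> n"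
    and avoid: "\<And>T t. T \<in> \<Theta> \<Longrightarrow>
      \<exists>a\<in>K. \<forall>n. \<forall>z::int. \<delta> n \<le> \<bar>t (h n) - u (h n) \<bullet> (T *v a) - s n * of_int z\<bar>"
    using grid_avoidance[where f = "\<lambda>i T a. u i \<bullet> (T *v a)" and K = K and \<Theta> = \<Theta>
      and L = "(1 + \<eta>) * N" and c = "\<kappa>/2" and h = h, OF K(1,2) _ _ lip sep] by metis
  define G where "G = {y. \<forall>n. \<forall>z::int. \<delta> n \<le> \<bar>u (h n) \<bullet> y - s n * of_int z\<bar>}"
  have "s \<longlonglongrightarrow> 0"
  proof (rule Lim_null_comparison)
    show "\<forall>\<^sub>F n in sequentially. norm (s n) \<le> (1/2)^n"
      using s by (intro always_eventually) (simp add: abs_of_pos)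
  qed (simp add: LIMSEQ_power_zero)
  moreover have "\<exists>i. u i \<bullet> w \<noteq> 0" if "w \<noteq> 0" for w
  proof (rule ccontr)
    assume "\<not> ?thesis"
    then have *: "w $ j + \<eta> * w $ i = 0" for i by (simp add: u)
    \<comment> \<open>This is the instance \<open>i = j\<close>; the other coordinates then vanish
      too.\<close>
    then have "(1 + \<eta>) * w $ j = 0" by (simp add: distrib_right)
    then have "w $ j = 0" using \<eta>(1) by simp
    then have "w = 0" using * \<eta>(1) by (simp add: vec_eq_iff)
    then show False using that by simp
  qed
  ultimately have G: "totally_disconnected_set G"
    unfolding G_def by (intro grid_complement_totally_disconnected s \<delta> h)
  obtain B where B: "\<And>a. a \<in> K \<Longrightarrow> norm a \<le> B"
    using compact_imp_bounded[OF K(1)] by (auto simp: bounded_iff)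
  have "closed G"
    unfolding G_def by (intro closed_Collect_all closed_Collect_le continuous_intros)
  \<comment> \<open>The radius accommodates every \<open>x - T *v a\<close> with \<open>x\<close> in
    the unit ball and \<open>a\<close> in \<open>K\<close>.\<close>
  then have "compact (cball 0 (1 + N * B) \<inter> G)" by (simp add: compact_Int_closed)
  then obtain K2 where K2: "compact K2" "perfect_subset K2" "K2 \<subseteq> cball 0 (1 + N * B) \<inter> G"
    and cnt: "countable (cball 0 (1 + N * B) \<inter> G - K2)"
    using compact_eq_perfect_Un_countable by blast
  have cover: "ball 0 1 \<subseteq> (*v) T ` K\<^sub>1 + K2" if T: "T \<in> \<Theta>" "invertible T" for T
  \<comment> \<open>The points of \<open>G\<close> found by grid avoidance may lie among the
    countably many removed from the ball's part of \<open>G\<close>. The Baire argument repairs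
    this, because the image of the totally disconnected \<open>K\<^sub>1\<close> under an invertible
    \<open>T\<close> has empty interior.\<close>
  proof (rule subset_set_plus_Un_countable[OF _ _ K2(1) cnt open_ball])
    show "compact ((*v) T ` K\<^sub>1)"
      by (intro compact_continuous_image K1(2) linear_continuous_on
          matrix_vector_mul_bounded_linear)
    show "interior ((*v) T ` K\<^sub>1) = {}"
      using interior_injective_linear_image[OF matrix_vector_mul_linear, of T K\<^sub>1] T(2)
        totally_disconnected_set_interior[OF K1(3)] by (simp add: inj_matrix_vector_mult)
    show "ball 0 1 \<subseteq> (*v) T ` K\<^sub>1 + (K2 \<union> (cball 0 (1 + N * B) \<inter> G - K2))"
    proof
      fix x :: "real^'d" assume x: "x \<in> ball 0 1"
      obtain a where a: "a \<in> K"
        "\<forall>n. \<forall>z::int. \<delta> n \<le> \<bar>u (h n) \<bullet> x - u (h n) \<bullet> (T *v a) - s n * of_int z\<bar>"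
        using avoid[OF T(1), of "\<lambda>i. u i \<bullet> x"] by blast
      then have "x - T *v a \<in> G" by (simp add: G_def inner_diff_right)
      moreover have "norm (T *v a) \<le> N * B"
        using normT[OF T(1), of a] B[OF a(1)] N by (meson mult_left_mono less_imp_le order_trans)
      then have "x - T *v a \<in> cball 0 (1 + N * B)"
        using x norm_triangle_ineq4[of x "T *v a"] by simp
      ultimately have "T *v a + (x - T *v a) \<in> (*v) T ` K\<^sub>1 + (K2 \<union> (cball 0 (1 + N * B) \<inter> G - K2))"
        using a(1) K(3) by (intro set_plus_intro) auto
      then show "x \<in> (*v) T ` K\<^sub>1 + (K2 \<union> (cball 0 (1 + N * B) \<inter> G - K2))" by simp
    qed
  qed
  have "T\<^sub>0 \<in> \<Theta>" using \<epsilon>(1) by (simp add: \<Theta>_def)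
  then have "0 \<in> (*v) T\<^sub>0 ` K\<^sub>1 + K2" using cover[of T\<^sub>0] assms(2) by auto
  then have "K2 \<noteq> {}" by (auto elim: set_plus_elim)
  then have "cantor_set K2"
    using K2 totally_disconnected_set_subset[OF G] by (simp add: cantor_set_def)
  moreover have "ball 0 1 \<subseteq> (\<Inter>T\<in>{T :: real^'d^'d. invertible T \<and> frobenius_norm (T - T\<^sub>0) < \<epsilon>}.
      ((*v) T) ` K\<^sub>1 + K2)"
    using cover by (auto simp: frobenius_norm_eq_norm \<Theta>_def)
  then have "0 \<in> interior (\<Inter>T\<in>{T :: real^'d^'d. invertible T \<and> frobenius_norm (T - T\<^sub>0) < \<epsilon>}.
      ((*v) T) ` K\<^sub>1 + K2)"
    by (rule interiorI[OF open_ball centre_in_ball[THEN iffD2, OF zero_less_one]])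
  ultimately show ?thesis using \<epsilon>(1) by blast
qed

end
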